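(* Let $n \ge 2$ and $m \ge 1$ be integers, and let $\{x_0, x_1, \ldots, x_m\}$ be a set of $m+1$ distinct points of the Hamming cube $H_n$ with $x_0 = \mathbf{0}$. If the vectors $x_0, x_1, \ldots, x_m$ are affinely independent in $\mathbb{R}^n$, then \[ \langle D^{-1}\mathbf{1}, \mathbf{1}\rangle = \frac{2}{\langle G^{-1}u, u\rangle} > 0 . \]
   Context: $H_n$ is the set $\{0,1\}^n \subset \mathbb{R}^n$ with the metric $d_1(x,y) = \|x-y\|_1 = \sum_{k=1}^n |x_k - y_k|$. $\mathbf{0}$ is the zero vector of $\mathbb{R}^n$. $D = (d_1(x_i,x_j))_{i,j=0}^m$ is the $(m+1)\times(m+1)$ distance matrix. $G = (x_i \cdot x_j)_{i,j=1}^m$ is the $m \times m$ Gram matrix of $x_1,\ldots,x_m$. ($D$ and $G$ are invertible under the affine independence hypothesis.) $u = (x_1\cdot x_1, \ldots, x_m \cdot x_m)^T \in \mathbb{R}^m$. $\mathbf{1}\in\mathbb{R}^{m+1}$ is the column vector all of whose coordinates are $1$, and $\langle\cdot,\cdot\rangle$ is the standard real inner product (on $\mathbb{R}^{m+1}$ or $\mathbb{R}^m$ as appropriate). *)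

theory Defs
  imports "HOL-Analysis.Analysis"
begin

definition hamming_cube :: "(real ^ 'n) set" where
  "hamming_cube = {x. \<forall>k. x $ k \<in> {0, 1}}"

definition d1 :: "real ^ 'n \<Rightarrow> real ^ 'n \<Rightarrow> real" where
  "d1 x y = (\<Sum>k\<in>UNIV. \<bar>x $ k - y $ k\<bar>)"

text \<open>
  A family \<open>x\<^sub>0, x\<^sub>1, \<dots>, x\<^sub>m\<close> is a function on \<^typ>\<open>'m option\<close> with \<open>m = CARD('m)\<close>:
  the index \<^term>\<open>None\<close> plays the role of \<open>0\<close>, and the indices \<^term>\<open>Some i\<close> play the
  role of \<open>1, \<dots>, m\<close>.
\<close>

definition distance_matrix :: "('m::finite option \<Rightarrow> real ^ 'n) \<Rightarrow> real ^ 'm option ^ 'm option" where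
  "distance_matrix x = (\<chi> i j. d1 (x i) (x j))"

definition gram_matrix :: "('m::finite option \<Rightarrow> real ^ 'n) \<Rightarrow> real ^ 'm ^ 'm" where
  "gram_matrix x = (\<chi> i j. x (Some i) \<bullet> x (Some j))"

definition gram_diagonal :: "('m::finite option \<Rightarrow> real ^ 'n) \<Rightarrow> real ^ 'm" where
  "gram_diagonal x = (\<chi> i. x (Some i) \<bullet> x (Some i))"

definition ones :: "real ^ 'k" where
  "ones = (\<chi> i. 1)"

end

theory Submission
  imports Defs
begin

text \<open>
  On the cube, \<open>\<bar>a - b\<bar> = a\<^sup>2 + b\<^sup>2 - 2ab\<close> coordinatewise, so \<open>D c\<close> is \<open>u \<bullet> c'\<close> in row \<open>0\<close> and
  \<open>\<sigma> u + (u \<bullet> c') 1 - 2 G c'\<close> in the other rows, where \<open>c'\<close> is \<open>c\<close> without its \<open>0\<close>-th entry and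
  \<open>\<sigma>\<close> is the sum of the entries of \<open>c\<close>. Hence \<open>D c\<close> is a multiple of \<open>1\<close> exactly if
  \<open>c' = (\<sigma> / 2) G\<^sup>-\<^sup>1 u\<close>, and the multiple is then \<open>(\<sigma> / 2) \<langle>G\<^sup>-\<^sup>1 u, u\<rangle>\<close>. As \<open>G\<close> is positive
  definite, this shows both that \<open>D\<close> has trivial kernel and that \<open>D c = 1\<close> forces
  \<open>\<sigma> = 2 / \<langle>G\<^sup>-\<^sup>1 u, u\<rangle>\<close>.
\<close>

lemma sum_UNIV_option:
  fixes f :: "'a::finite option \<Rightarrow> 'b::comm_monoid_add"
  shows "(\<Sum>j\<in>UNIV. f j) = f None + (\<Sum>i\<in>UNIV. f (Some i))"
  by (simp add: UNIV_option_conv sum.reindex)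

lemma invertible_iff_trivial_kernel:
  fixes A :: "real ^ 'n ^ 'n"
  shows "invertible A \<longleftrightarrow> (\<forall>v. A *v v = 0 \<longrightarrow> v = 0)"
  by (simp add: invertible_left_inverse matrix_left_invertible_ker)

lemma matrix_inv_mult_eq_iff:
  fixes A :: "real ^ 'n ^ 'n"
  assumes "invertible A"
  shows "matrix_inv A *v b = c \<longleftrightarrow> A *v c = b"
proof -
  have "A ** matrix_inv A = mat 1 \<and> matrix_inv A ** A = mat 1"
    using assms unfolding invertible_def matrix_inv_def by (rule someI_ex)
  then show ?thesis
    by (metis matrix_vector_mul_assoc matrix_vector_mul_lid)
qed

lemma d1_hamming_cube:
  fixes x y :: "real ^ 'n"
  assumes "x \<in> hamming_cube" "y \<in> hamming_cube"
  shows "d1 x y = x \<bullet> x + y \<bullet> y - 2 * (x \<bullet> y)"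
proof -
  have "\<bar>x $ k - y $ k\<bar> = x $ k * x $ k + y $ k * y $ k - 2 * (x $ k * y $ k)" for k
    using assms by (auto simp: hamming_cube_def dest!: spec[of _ k])
  then show ?thesis
    by (simp add: d1_def inner_vec_def sum.distrib sum_subtractf sum_distrib_left)
qed

text \<open>For \<open>v = w\<close> the right side is a squared norm; positivity of the Gram form
  comes from here.\<close>

lemma gram_matrix_inner:
  "(gram_matrix x *v v) \<bullet> w
    = (\<Sum>i\<in>UNIV. w $ i *\<^sub>R x (Some i)) \<bullet> (\<Sum>i\<in>UNIV. v $ i *\<^sub>R x (Some i))"
  by (simp add: inner_vec_def[of "vec_lambda _"] matrix_vector_mult_def gram_matrix_def
      inner_sum_right inner_sum_left sum_distrib_right sum_distrib_left mult_ac) (rule sum.swap)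

text \<open>With the origin among the points, affine independence of all of them amounts to linear
  independence of the others.\<close>

lemma affine_independent_imp_trivial_combination:
  fixes x :: "'m::finite option \<Rightarrow> 'v::real_vector"
  assumes "inj x" "x None = 0" "\<not> affine_dependent (range x)"
    and "(\<Sum>i\<in>UNIV. v i *\<^sub>R x (Some i)) = 0"
  shows "v i = 0"
proof -
  have inj: "inj (\<lambda>i. x (Some i))"
    using assms(1) by (auto simp: inj_def)
  have "0 \<notin> range (\<lambda>i. x (Some i))"
    using assms(1,2) by (metis inj_eq option.distinct(1) rangeE)
  moreover have "range x = insert 0 (range (\<lambda>i. x (Some i)))"
    using assms(2) by (simp add: UNIV_option_conv image_image)
  ultimately have indep: "independent (range (\<lambda>i. x (Some i)))"
    using assms(3) by (simp add: affine_dependent_iff_dependent)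
  \<comment> \<open>Linear independence concerns a set of vectors, so the coefficients are moved
    from indices to points, which injectivity permits.\<close>
  define u where "u = v \<circ> inv (\<lambda>i. x (Some i))"
  have u: "u (x (Some i)) = v i" for i
    using inv_f_f[OF inj, of i] by (simp add: u_def)
  have "(\<Sum>y\<in>range (\<lambda>i. x (Some i)). u y *\<^sub>R y) = 0"
    using assms(4) by (simp add: sum.reindex[OF inj] u)
  then have "\<forall>y\<in>range (\<lambda>i. x (Some i)). u y = 0"
    using indep by (auto simp: dependent_finite)
  then show ?thesis
    using u by auto
qed

lemma gram_matrix_pos_def:
  fixes x :: "'m::finite option \<Rightarrow> real ^ 'n"
  assumes "inj x" "x None = 0" "\<not> affine_dependent (range x)" "v \<noteq> 0"
  shows "(gram_matrix x *v v) \<bullet> v > 0"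
proof -
  have "(\<Sum>i\<in>UNIV. v $ i *\<^sub>R x (Some i)) \<noteq> 0"
    using affine_independent_imp_trivial_combination[OF assms(1-3), of "($) v"] \<open>v \<noteq> 0\<close>
    by (auto simp: vec_eq_iff)
  then show ?thesis
    by (simp add: gram_matrix_inner)
qed

lemma distance_matrix_mult:
  fixes x :: "'m::finite option \<Rightarrow> real ^ 'n"
  assumes "range x \<subseteq> hamming_cube" "x None = 0"
  defines "c' \<equiv> \<lambda>c :: real ^ 'm option. \<chi> i. c $ Some i"
  shows "(distance_matrix x *v c) $ None = gram_diagonal x \<bullet> c' c"
    and "(distance_matrix x *v c) $ Some i
      = (c \<bullet> ones) * gram_diagonal x $ i + gram_diagonal x \<bullet> c' c - 2 * (gram_matrix x *v c' c) $ i"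
proof -
  have d: "d1 (x i) (x j) = x i \<bullet> x i + x j \<bullet> x j - 2 * (x i \<bullet> x j)" for i j
    using assms(1) by (intro d1_hamming_cube) auto
  show "(distance_matrix x *v c) $ None = gram_diagonal x \<bullet> c' c"
    using assms(2)
    by (simp add: matrix_vector_mult_def distance_matrix_def d sum_UNIV_option
        gram_diagonal_def c'_def inner_vec_def[of "vec_lambda _"])
  show "(distance_matrix x *v c) $ Some i
      = (c \<bullet> ones) * gram_diagonal x $ i + gram_diagonal x \<bullet> c' c - 2 * (gram_matrix x *v c' c) $ i"
    using assms(2)
    by (simp add: matrix_vector_mult_def distance_matrix_def d sum_UNIV_option
        gram_diagonal_def gram_matrix_def c'_def inner_vec_def[of "vec_lambda _"]
        inner_vec_def[of c] ones_def algebra_simps sum.distrib sum_subtractf sum_distrib_left sum_distrib_right)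
qed

theorem corollary3p4:
  fixes x :: "'m::finite option \<Rightarrow> real ^ 'n"
  assumes "CARD('n) \<ge> 2"
    and "range x \<subseteq> hamming_cube"
    and "inj x"
    and "x None = 0"
    and "\<not> affine_dependent (range x)"
  shows "invertible (distance_matrix x) \<and> invertible (gram_matrix x) \<and>
    (matrix_inv (distance_matrix x) *v ones) \<bullet> ones
      = 2 / ((matrix_inv (gram_matrix x) *v gram_diagonal x) \<bullet> gram_diagonal x) \<and>
    2 / ((matrix_inv (gram_matrix x) *v gram_diagonal x) \<bullet> gram_diagonal x) > 0"
proof -
  let ?D = "distance_matrix x" and ?G = "gram_matrix x" and ?u = "gram_diagonal x"
  note pos = gram_matrix_pos_def[OF assms(3-5)]
  have G: "invertible ?G"
    using pos by (force simp: invertible_iff_trivial_kernel)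
  define w where "w = matrix_inv ?G *v ?u"
  define s where "s = w \<bullet> ?u"
  have Gw: "?G *v w = ?u"
    using matrix_inv_mult_eq_iff[OF G] w_def by blast
  have "x (Some i) \<noteq> 0" for i
    using assms(3,4) by (metis inj_eq option.distinct(1))
  \<comment> \<open>Each entry is the squared norm of a nonzero vector, and the index type is
    nonempty.\<close>
  then have "?u \<noteq> 0"
    by (simp add: gram_diagonal_def vec_eq_iff)
  then have "w \<noteq> 0"
    using Gw by auto
  \<comment> \<open>By \<open>Gw\<close>, \<open>s\<close> is the value of the Gram form at
    \<open>w\<close>.\<close>
  then have s: "s > 0"
    using pos[of w] Gw by (simp add: s_def inner_commute)
  \<comment> \<open>A general \<open>t\<close> serves both uses: \<open>t = 0\<close> describes the
    kernel of \<open>?D\<close>, and \<open>t = 1\<close> gives the value sought.\<close>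
  have solution: "c \<bullet> ones = 2 * t / s \<and> (\<chi> i. c $ Some i) = (t / s) *\<^sub>R w"
    if c: "?D *v c = t *\<^sub>R ones" for c t
  proof -
    let ?c' = "\<chi> i. c $ Some i" and ?\<sigma> = "c \<bullet> ones"
    have t: "?u \<bullet> ?c' = t"
      using distance_matrix_mult(1)[OF assms(2,4), of c] c by (simp add: ones_def)
    \<comment> \<open>In row \<open>Some i\<close> the summand \<open>?u \<bullet> ?c'\<close>
      cancels against the right-hand side \<open>t\<close>.\<close>
    have "(?G *v ?c') $ i = (?\<sigma> / 2) * ?u $ i" for i
      using distance_matrix_mult(2)[OF assms(2,4), of c i] c t by (simp add: ones_def)
    then have "?G *v ?c' = (?\<sigma> / 2) *\<^sub>R ?u"
      by (simp add: vec_eq_iff)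
    also have "\<dots> = ?G *v ((?\<sigma> / 2) *\<^sub>R w)"
      by (simp add: matrix_vector_mult_scaleR Gw)
    finally have c': "?c' = (?\<sigma> / 2) *\<^sub>R w"
      by (metis G matrix_inv_mult_eq_iff)
    then have "t = ?\<sigma> / 2 * s"
      using t by (simp add: s_def inner_commute)
    then show ?thesis
      using c' s by (simp add: field_simps)
  qed
  have D: "invertible ?D"
    unfolding invertible_iff_trivial_kernel
  proof (intro allI impI)
    fix c assume "?D *v c = 0"
    then have "c \<bullet> ones = 0" and "\<And>i. c $ Some i = 0"
      using solution[of c 0] by (simp_all add: vec_eq_iff)
    \<comment> \<open>Once the other entries vanish, the entry at \<open>None\<close> equals the
      coordinate sum, which is zero.\<close>
    then have "c $ j = 0" for j
      by (cases j) (simp_all add: inner_vec_def ones_def sum_UNIV_option)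
    then show "c = 0"
      by (simp add: vec_eq_iff)
  qed
  have "?D *v (matrix_inv ?D *v ones) = 1 *\<^sub>R ones"
    using matrix_inv_mult_eq_iff[OF D] by (metis scaleR_one)
  then have "(matrix_inv ?D *v ones) \<bullet> ones = 2 / s"
    using solution by fastforce
  then show ?thesis
    using D G s by (simp add: s_def w_def)
qed

end
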